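(* Let $c>0$ and let $u=u(t,x)$, $t\ge 0$, $x\in\mathbf R$, be a solution of the one-dimensional wave equation \[ u_{tt}-c^2u_{xx}=0 \] such that $u(0,\cdot)$ and $\partial_t u(0,\cdot)$ belong to the Schwartz class $\mathcal S(\mathbf R)$. Then for every $v\in\mathbf R$ with $|v|\neq c$, every $x_0\in\mathbf R$ and every non-negative integer $l$ there is a constant $C$ such that \[ |\partial_t u(t,x_0+vt)|^2+c^2|u_x(t,x_0+vt)|^2\le C\,t^{-2l} \] for all $t>0$.
   Context: Subscripts denote partial derivatives. Solutions are classical ($C^2$) solutions. The constant $C$ may depend on $u$, $c$, $v$, $x_0$ and $l$, but not on $t$. *)

theory Defs
  imports "HOL-Analysis.Analysis"
begin

(* Functions of (t, x) live on the closed half-plane t >= 0. The time derivative is taken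
   within {0..}: it is the usual one for t > 0 and one-sided at t = 0, and values of u at
   negative times never matter. *)

definition partial_t :: "(real \<Rightarrow> real \<Rightarrow> complex) \<Rightarrow> real \<Rightarrow> real \<Rightarrow> complex" where
  "partial_t u t x = vector_derivative (\<lambda>s. u s x) (at t within {0..})"

definition partial_x :: "(real \<Rightarrow> real \<Rightarrow> complex) \<Rightarrow> real \<Rightarrow> real \<Rightarrow> complex" where
  "partial_x u t x = vector_derivative (\<lambda>y. u t y) (at x)"

definition C0_half :: "(real \<Rightarrow> real \<Rightarrow> complex) \<Rightarrow> bool" where
  "C0_half u \<longleftrightarrow> continuous_on ({0..} \<times> UNIV) (\<lambda>(t, x). u t x)"

definition has_partials_half :: "(real \<Rightarrow> real \<Rightarrow> complex) \<Rightarrow> bool" where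
  "has_partials_half u \<longleftrightarrow>
     (\<forall>t\<ge>0. \<forall>x. (\<lambda>s. u s x) differentiable (at t within {0..}) \<and>
               (\<lambda>y. u t y) differentiable (at x))"

definition C1_half :: "(real \<Rightarrow> real \<Rightarrow> complex) \<Rightarrow> bool" where
  "C1_half u \<longleftrightarrow> C0_half u \<and> has_partials_half u \<and>
     C0_half (partial_t u) \<and> C0_half (partial_x u)"

definition C2_half :: "(real \<Rightarrow> real \<Rightarrow> complex) \<Rightarrow> bool" where
  "C2_half u \<longleftrightarrow> C1_half u \<and> C1_half (partial_t u) \<and> C1_half (partial_x u)"

definition wave_solution :: "real \<Rightarrow> (real \<Rightarrow> real \<Rightarrow> complex) \<Rightarrow> bool" where
  "wave_solution c u \<longleftrightarrow> C2_half u \<and>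
     (\<forall>t\<ge>0. \<forall>x. partial_t (partial_t u) t x - c\<^sup>2 *\<^sub>R partial_x (partial_x u) t x = 0)"

definition nth_vderiv :: "nat \<Rightarrow> (real \<Rightarrow> complex) \<Rightarrow> real \<Rightarrow> complex" where
  "nth_vderiv k f = ((\<lambda>g y. vector_derivative g (at y)) ^^ k) f"

definition schwartz :: "(real \<Rightarrow> complex) \<Rightarrow> bool" where
  "schwartz f \<longleftrightarrow>
     (\<forall>k x. nth_vderiv k f differentiable (at x)) \<and>
     (\<forall>j k. bounded (range (\<lambda>x. x ^ j *\<^sub>R nth_vderiv k f x)))"

end

theory Submission
  imports Defs
begin

text \<open>
  The quantities \<open>u_t - c u_x\<close> and \<open>u_t + c u_x\<close> (the Riemann invariants of the wave equation)
  solve transport equations: the first is constant along each line \<open>x = y + c t\<close>, the second along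
  each line \<open>x = y - c t\<close>. By the parallelogram law the energy density
  \<open>|u_t|\<^sup>2 + c\<^sup>2 |u_x|\<^sup>2\<close> is half the sum of their squared norms. At the point \<open>(t, x0 + v t)\<close> it
  is therefore determined by the initial data at the two feet \<open>x0 + (v - c) t\<close> and
  \<open>x0 + (v + c) t\<close>. As \<open>|v| \<noteq> c\<close>, both feet move to infinity at a nonzero constant speed, where
  the data decay faster than every power.

  The transport equation (\<open>riemann_invariant_transported\<close>) is the chain rule along a line
  (\<open>C1_half_derivative_along_line\<close>) together with the symmetry of the mixed partial derivatives of
  \<open>u\<close>. The symmetry is proved up to the boundary \<open>t = 0\<close> of the half-plane, from difference quotients
  over small squares having the point in question as their lower left corner
  (\<open>mixed_partials_commute\<close>). The decay at the feet is \<open>rapidly_decreasing_along_ray\<close>.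
\<close>

section \<open>Symmetry of mixed partial derivatives at a corner\<close>

text \<open>
  A mean value inequality, applied to \<open>f x - x A\<close>. For vector-valued functions it replaces the
  mean value theorem, which classical proofs of the symmetry of second derivatives use.
\<close>

lemma increment_bound:
  fixes f :: "real \<Rightarrow> 'a::real_normed_vector"
  assumes "a \<le> b"
    and deriv: "\<And>x. x \<in> {a..b} \<Longrightarrow> (f has_vector_derivative f' x) (at x within {a..b})"
    and bound: "\<And>x. x \<in> {a..b} \<Longrightarrow> norm (f' x - A) \<le> B"
  shows "norm (f b - f a - (b - a) *\<^sub>R A) \<le> B * (b - a)"
proof -
  have "norm ((f b - b *\<^sub>R A) - (f a - a *\<^sub>R A)) \<le> B * norm (b - a)"
  proof (rule differentiable_bound[where S = "{a..b}" and f' = "\<lambda>x h. h *\<^sub>R (f' x - A)"])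
    fix x assume x: "x \<in> {a..b}"
    have "((\<lambda>x. f x - x *\<^sub>R A) has_vector_derivative f' x - A) (at x within {a..b})"
      by (auto intro!: derivative_eq_intros deriv x)
    then show "((\<lambda>x. f x - x *\<^sub>R A) has_derivative (\<lambda>h. h *\<^sub>R (f' x - A))) (at x within {a..b})"
      by (simp add: has_vector_derivative_def)
    show "onorm (\<lambda>h. h *\<^sub>R (f' x - A)) \<le> B"
      using bound[OF x] by (intro onorm_le) (simp add: mult.commute[of B] mult_left_mono)
  qed (use assms in auto)
  then show ?thesis
    using assms(1) by (simp add: algebra_simps)
qed

text \<open>
  The second difference of \<open>f\<close> over a rectangle is the area times the mixed derivative, with an
  error controlled by the oscillation of that derivative: the mean value inequality is used once in
  each variable. Exchanging the two variables leaves the second difference unchanged, so the lemma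
  can be used for both orders of differentiation.
\<close>

lemma mixed_difference_bound:
  fixes f :: "real \<Rightarrow> real \<Rightarrow> 'a::real_normed_vector"
  assumes "0 \<le> h" "0 \<le> k"
    and fs: "\<And>s y. s \<in> {a..a+h} \<Longrightarrow> y \<in> {b..b+k} \<Longrightarrow>
               ((\<lambda>s. f s y) has_vector_derivative p s y) (at s within {a..a+h})"
    and ps: "\<And>s y. s \<in> {a..a+h} \<Longrightarrow> y \<in> {b..b+k} \<Longrightarrow>
               ((\<lambda>y. p s y) has_vector_derivative q s y) (at y within {b..b+k})"
    and bound: "\<And>s y. s \<in> {a..a+h} \<Longrightarrow> y \<in> {b..b+k} \<Longrightarrow> norm (q s y - A) \<le> B"
  shows "norm ((f (a+h) (b+k) - f (a+h) b) - (f a (b+k) - f a b) - (h * k) *\<^sub>R A) \<le> B * (h * k)"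
proof -
  have inner: "norm (p s (b+k) - p s b - k *\<^sub>R A) \<le> B * k" if "s \<in> {a..a+h}" for s
    using increment_bound[of b "b+k" "p s" "q s" A B] ps bound that assms(2) by simp
  have "norm ((f (a+h) (b+k) - f (a+h) b) - (f a (b+k) - f a b) - (a + h - a) *\<^sub>R (k *\<^sub>R A))
      \<le> (B * k) * (a + h - a)"
  proof (rule increment_bound)
    fix s assume s: "s \<in> {a..a+h}"
    show "((\<lambda>s. f s (b+k) - f s b) has_vector_derivative p s (b+k) - p s b) (at s within {a..a+h})"
      using fs[OF s] assms(2) by (auto intro!: derivative_eq_intros)
  qed (use inner assms(1) in auto)
  then show ?thesis
    by (simp add: mult_ac)
qed

text \<open>
  Over a small square with corner \<open>(a, b)\<close> the second difference is close to the area times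
  either of the two mixed derivatives. All derivatives are one-sided and only the quadrant above
  \<open>(a, b)\<close> is involved, so the result covers boundary points of the half-plane.
\<close>

lemma mixed_partials_commute:
  fixes f :: "real \<Rightarrow> real \<Rightarrow> 'a::real_normed_vector"
  assumes fs: "\<And>s y. s \<ge> a \<Longrightarrow> y \<ge> b \<Longrightarrow>
               ((\<lambda>s. f s y) has_vector_derivative fs s y) (at s within {a..})"
    and fsy: "\<And>s y. s \<ge> a \<Longrightarrow> y \<ge> b \<Longrightarrow>
               ((\<lambda>y. fs s y) has_vector_derivative fsy s y) (at y within {b..})"
    and fy: "\<And>s y. s \<ge> a \<Longrightarrow> y \<ge> b \<Longrightarrow>
               ((\<lambda>y. f s y) has_vector_derivative fy s y) (at y within {b..})"
    and fys: "\<And>s y. s \<ge> a \<Longrightarrow> y \<ge> b \<Longrightarrow>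
               ((\<lambda>s. fy s y) has_vector_derivative fys s y) (at s within {a..})"
    and cont_fsy: "continuous (at (a, b) within {a..} \<times> {b..}) (\<lambda>(s, y). fsy s y)"
    and cont_fys: "continuous (at (a, b) within {a..} \<times> {b..}) (\<lambda>(s, y). fys s y)"
  shows "fsy a b = fys a b"
proof -
  have "norm (fsy a b - fys a b) \<le> 2 * e" if e: "e > 0" for e
  proof -
    obtain d1 where d1: "d1 > 0"
      "\<And>s y. s \<ge> a \<Longrightarrow> y \<ge> b \<Longrightarrow> dist (s, y) (a, b) < d1 \<Longrightarrow> dist (fsy s y) (fsy a b) < e"
      using cont_fsy[unfolded continuous_within_eps_delta, rule_format, OF e] by auto
    obtain d2 where d2: "d2 > 0"
      "\<And>s y. s \<ge> a \<Longrightarrow> y \<ge> b \<Longrightarrow> dist (s, y) (a, b) < d2 \<Longrightarrow> dist (fys s y) (fys a b) < e"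
      using cont_fys[unfolded continuous_within_eps_delta, rule_format, OF e] by auto
    \<comment> \<open>Points of the square of side \<open>h\<close> are within \<open>2 h\<close> of the corner, which must stay below \<open>d1\<close> and \<open>d2\<close>.\<close>
    define h where "h = min d1 d2 / 3"
    have h: "h > 0"
      using d1(1) d2(1) by (simp add: h_def)
    have near: "dist (s, y) (a, b) < d1 \<and> dist (s, y) (a, b) < d2"
      if "s \<in> {a..a+h}" "y \<in> {b..b+h}" for s y
    proof -
      have "dist (s, y) (a, b) \<le> \<bar>s - a\<bar> + \<bar>y - b\<bar>"
        by (simp add: dist_Pair_Pair dist_real_def sqrt_sum_squares_le_sum_abs)
      also have "\<dots> \<le> 2 * h"
        using that by auto
      also have "2 * h < min d1 d2"
        using d1(1) d2(1) by (auto simp: h_def min_def)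
      finally show ?thesis by simp
    qed
    have bound1: "norm (fsy s y - fsy a b) \<le> e" and bound2: "norm (fys s y - fys a b) \<le> e"
      if "s \<in> {a..a+h}" "y \<in> {b..b+h}" for s y
      using near[OF that] d1(2)[of s y] d2(2)[of s y] that by (auto simp: dist_norm intro: less_imp_le)
    let ?D = "(f (a+h) (b+h) - f (a+h) b) - (f a (b+h) - f a b)"
    have 1: "norm (?D - (h * h) *\<^sub>R fsy a b) \<le> e * (h * h)"
      by (rule mixed_difference_bound[where p = fs and q = fsy])
        (use h bound1 in \<open>auto intro: has_vector_derivative_within_subset[OF fs] has_vector_derivative_within_subset[OF fsy]\<close>)
    have "norm ((f (a+h) (b+h) - f a (b+h)) - (f (a+h) b - f a b) - (h * h) *\<^sub>R fys a b) \<le> e * (h * h)"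
      by (rule mixed_difference_bound[where p = "\<lambda>y s. fy s y" and q = "\<lambda>y s. fys s y"
            and f = "\<lambda>y s. f s y" and a = b and b = a])
        (use h bound2 in \<open>auto intro: has_vector_derivative_within_subset[OF fy] has_vector_derivative_within_subset[OF fys]\<close>)
    then have 2: "norm (?D - (h * h) *\<^sub>R fys a b) \<le> e * (h * h)"
      by (simp add: algebra_simps)
    have "(h * h) *\<^sub>R (fsy a b - fys a b)
        = (?D - (h * h) *\<^sub>R fys a b) - (?D - (h * h) *\<^sub>R fsy a b)"
      by (simp add: scaleR_diff_right)
    then have "norm ((h * h) *\<^sub>R (fsy a b - fys a b)) \<le> e * (h * h) + e * (h * h)"
      using norm_triangle_le_diff[OF add_mono[OF 2 1]] by simp
    then have "(h * h) * norm (fsy a b - fys a b) \<le> (h * h) * (2 * e)"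
      by (simp add: mult_ac)
    then show ?thesis
      using h by (simp only: mult_le_cancel_left_pos[OF mult_pos_pos[OF h h]])
  qed
  from this[of "norm (fsy a b - fys a b) / 4"] show ?thesis
    by (cases "fsy a b = fys a b") auto
qed

section \<open>Calculus on the closed half-plane\<close>

lemma C0_half_continuous_within:
  assumes "C0_half w" "t \<ge> 0" "S \<subseteq> {0..} \<times> UNIV"
  shows "continuous (at (t, x) within S) (\<lambda>(t, x). w t x)"
  using assms unfolding C0_half_def continuous_on_eq_continuous_within
  by (meson SigmaI UNIV_I atLeast_iff continuous_within_subset)

lemma has_partial_derivatives:
  assumes "C1_half w" "t \<ge> 0"
  shows has_partial_t: "((\<lambda>s. w s x) has_vector_derivative partial_t w t x) (at t within {0..})"
    and has_partial_x: "((\<lambda>y. w t y) has_vector_derivative partial_x w t x) (at x)"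
  using assms unfolding C1_half_def has_partials_half_def partial_t_def partial_x_def
  by (auto simp: vector_derivative_works[symmetric])

lemma C2_half_partials_commute:
  assumes "C2_half u" "t \<ge> 0"
  shows "partial_x (partial_t u) t x = partial_t (partial_x u) t x"
proof -
  have C1: "C1_half u" "C1_half (partial_t u)" "C1_half (partial_x u)"
    using assms(1) by (auto simp: C2_half_def)
  have corner: "{t..} \<times> {x..} \<subseteq> {0..} \<times> (UNIV :: real set)"
    using assms(2) by auto
  show ?thesis
  proof (rule mixed_partials_commute[where f = u and fs = "partial_t u" and fy = "partial_x u"])
    show "continuous (at (t, x) within {t..} \<times> {x..}) (\<lambda>(s, y). partial_x (partial_t u) s y)"
      "continuous (at (t, x) within {t..} \<times> {x..}) (\<lambda>(s, y). partial_t (partial_x u) s y)"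
      using C1 assms(2) corner by (auto simp: C1_half_def intro!: C0_half_continuous_within)
  qed (use assms(2) in \<open>auto intro: has_vector_derivative_within_subset[OF has_partial_t[OF C1(1)]]
        has_vector_derivative_within_subset[OF has_partial_x[OF C1(1)]]
        has_vector_derivative_within_subset[OF has_partial_x[OF C1(2)]]
        has_vector_derivative_within_subset[OF has_partial_t[OF C1(3)]]\<close>)
qed

text \<open>
  Continuous partial derivatives give total differentiability within the half-plane, hence the
  chain rule along the line \<open>x = y + e t\<close>, one-sided at \<open>t = 0\<close>.
\<close>

lemma C1_half_derivative_along_line:
  assumes C1: "C1_half w" and t: "t \<ge> 0"
  shows "((\<lambda>s. w s (y + e * s)) has_vector_derivative
           partial_t w t (y + e * t) + e *\<^sub>R partial_x w t (y + e * t)) (at t within {0..})"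
proof -
  let ?x = "y + e * t"
  have "((\<lambda>(s, x). w s x) has_derivative
      (\<lambda>(ds, dx). ds *\<^sub>R partial_t w t ?x + blinfun_scaleR_left (partial_x w t ?x) dx))
      (at (t, ?x) within {0..} \<times> UNIV)"
  proof (rule has_derivative_partialsI)
    show "((\<lambda>s. w s ?x) has_derivative (\<lambda>ds. ds *\<^sub>R partial_t w t ?x)) (at t within {0..})"
      using has_partial_t[OF C1 t] by (simp add: has_vector_derivative_def)
    show "((\<lambda>x. w s x) has_derivative blinfun_apply (blinfun_scaleR_left (partial_x w s x)))
        (at x within UNIV)" if "s \<in> {0..}" for s x
      using has_partial_x[OF C1, of s x] that by (simp add: has_vector_derivative_def)
    have "continuous (at (t, ?x) within {0..} \<times> UNIV) (\<lambda>(s, x). partial_x w s x)"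
      using C1 t by (intro C0_half_continuous_within) (auto simp: C1_half_def)
    then show "continuous (at (t, ?x) within {0..} \<times> UNIV) (\<lambda>(s, x). blinfun_scaleR_left (partial_x w s x))"
      unfolding continuous_within case_prod_unfold
      by (rule bounded_linear.tendsto[OF bounded_linear_blinfun_scaleR_left])
  qed auto
  moreover have "((\<lambda>s. (s, y + e * s)) has_derivative (\<lambda>ds. (ds, e * ds))) (at t within {0..})"
    by (auto intro!: derivative_eq_intros)
  ultimately have "((\<lambda>s. case (s, y + e * s) of (s, x) \<Rightarrow> w s x) has_derivative
      (\<lambda>h. case (h, e * h) of (ds, dx) \<Rightarrow>
        ds *\<^sub>R partial_t w t ?x + blinfun_scaleR_left (partial_x w t ?x) dx)) (at t within {0..})"
    by (intro has_derivative_in_compose[where g = "\<lambda>(s, x). w s x" and f = "\<lambda>s. (s, y + e * s)"]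
        has_derivative_subset[where t = "(\<lambda>s. (s, y + e * s)) ` {0..}"]) auto
  then show ?thesis
    by (simp add: has_vector_derivative_def scaleR_add_right mult.commute)
qed

section \<open>Riemann invariants\<close>

text \<open>
  The derivative of \<open>u_t - e u_x\<close> along \<open>x = y + e t\<close> is
  \<open>u_tt - e\<^sup>2 u_xx + e (u_tx - u_xt)\<close>, which vanishes. Assuming only \<open>e\<^sup>2 = c\<^sup>2\<close> covers both
  families of characteristics, \<open>e = c\<close> and \<open>e = - c\<close>.
\<close>

lemma riemann_invariant_transported:
  assumes u: "wave_solution c u" and e: "e\<^sup>2 = c\<^sup>2" and t: "t \<ge> 0"
  shows "partial_t u t x - e *\<^sub>R partial_x u t x
       = partial_t u 0 (x - e * t) - e *\<^sub>R partial_x u 0 (x - e * t)"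
proof -
  have C2: "C2_half u"
    and wave: "\<And>t x. t \<ge> 0 \<Longrightarrow> partial_t (partial_t u) t x = e\<^sup>2 *\<^sub>R partial_x (partial_x u) t x"
    using u e by (auto simp: wave_solution_def)
  have C1: "C1_half (partial_t u)" "C1_half (partial_x u)"
    using C2 by (auto simp: C2_half_def)
  let ?y = "x - e * t"
  let ?w = "\<lambda>s. partial_t u s (?y + e * s) - e *\<^sub>R partial_x u s (?y + e * s)"
  have "(?w has_vector_derivative 0) (at s within {0..})" if "s \<in> {0..}" for s
  proof -
    have s: "s \<ge> 0" using that by simp
    note d = has_vector_derivative_diff[OF C1_half_derivative_along_line[OF C1(1) s]
        bounded_linear.has_vector_derivative[OF bounded_linear_scaleR_right
          C1_half_derivative_along_line[OF C1(2) s]]]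
    show ?thesis
      using d[of ?y e e ?y e] wave[OF s] C2_half_partials_commute[OF C2 s]
      by (simp add: scaleR_add_right power2_eq_square)
  qed
  from has_vector_derivative_zero_constant[OF _ this]
  obtain k where "\<And>s. s \<in> {0..} \<Longrightarrow> ?w s = k"
    by (auto simp: convex_real_interval)
  from this[of 0] this[of t] t show ?thesis by simp
qed

section \<open>Rapid decay of the initial data\<close>

definition rapidly_decreasing :: "(real \<Rightarrow> 'a::real_normed_vector) \<Rightarrow> bool" where
  "rapidly_decreasing f \<longleftrightarrow> (\<forall>j. bounded (range (\<lambda>x. x ^ j *\<^sub>R f x)))"

lemma rapidly_decreasing_lincomb:
  assumes "rapidly_decreasing f" "rapidly_decreasing g"
  shows "rapidly_decreasing (\<lambda>x. f x - e *\<^sub>R g x)"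
  unfolding rapidly_decreasing_def
proof
  fix j
  have "bounded (range (\<lambda>x. x ^ j *\<^sub>R f x - e *\<^sub>R (x ^ j *\<^sub>R g x)))"
    using assms bounded_scaling[of "range (\<lambda>x. x ^ j *\<^sub>R g x)" e]
    by (intro bounded_minus_comp) (auto simp: rapidly_decreasing_def image_image)
  then show "bounded (range (\<lambda>x. x ^ j *\<^sub>R (f x - e *\<^sub>R g x)))"
    by (simp add: scaleR_diff_right mult.commute)
qed

lemma schwartz_rapidly_decreasing:
  assumes "schwartz f"
  shows "rapidly_decreasing f" "rapidly_decreasing (\<lambda>x. vector_derivative f (at x))"
proof -
  have "bounded (range (\<lambda>x. x ^ j *\<^sub>R nth_vderiv k f x))" for j k
    using assms by (simp add: schwartz_def)
  from this[of _ 0] this[of _ 1]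
  show "rapidly_decreasing f" "rapidly_decreasing (\<lambda>x. vector_derivative f (at x))"
    by (simp_all add: rapidly_decreasing_def nth_vderiv_def)
qed

text \<open>
  With \<open>y = x0 + a t\<close> one has \<open>|a| t \<le> |y| + |x0|\<close>, so up to constants \<open>t ^ l\<close> is at most
  \<open>|y| ^ l + |x0| ^ l\<close>; the two terms are absorbed by the bounds of \<open>f\<close> weighted with the powers
  \<open>l\<close> and \<open>0\<close>. The bound is uniform down to \<open>t = 0\<close>.
\<close>

lemma rapidly_decreasing_along_ray:
  assumes f: "rapidly_decreasing f" and a: "a \<noteq> 0"
  shows "\<exists>K. \<forall>t>0. t ^ l * norm (f (x0 + a * t)) \<le> K"
proof -
  have "\<exists>B. \<forall>x. norm (x ^ j *\<^sub>R f x) \<le> B" for j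
    using f unfolding rapidly_decreasing_def bounded_iff by auto
  then obtain M N where M: "\<And>x. norm (x ^ l *\<^sub>R f x) \<le> M"
    and N: "\<And>x. norm (x ^ 0 *\<^sub>R f x) \<le> N"
    by metis
  have "t ^ l * norm (f (x0 + a * t)) \<le> (2 / \<bar>a\<bar>) ^ l * (M + \<bar>x0\<bar> ^ l * N)" if "t > 0" for t
  proof -
    define y where "y = x0 + a * t"
    have "\<bar>a\<bar> * t = \<bar>y - x0\<bar>"
      using that by (simp add: y_def abs_mult)
    also have "\<dots> \<le> 2 * max \<bar>y\<bar> \<bar>x0\<bar>"
      by simp
    finally have "t \<le> 2 / \<bar>a\<bar> * max \<bar>y\<bar> \<bar>x0\<bar>"
      using a by (simp add: field_simps)
    then have "t ^ l \<le> (2 / \<bar>a\<bar> * max \<bar>y\<bar> \<bar>x0\<bar>) ^ l"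
      using that by (intro power_mono) auto
    also have "\<dots> = (2 / \<bar>a\<bar>) ^ l * max \<bar>y\<bar> \<bar>x0\<bar> ^ l"
      by (rule power_mult_distrib)
    also have "\<dots> \<le> (2 / \<bar>a\<bar>) ^ l * (\<bar>y\<bar> ^ l + \<bar>x0\<bar> ^ l)"
      by (intro mult_left_mono) (auto simp: max_def)
    finally have "t ^ l * norm (f y) \<le> (2 / \<bar>a\<bar>) ^ l * (\<bar>y\<bar> ^ l + \<bar>x0\<bar> ^ l) * norm (f y)"
      by (intro mult_right_mono) auto
    also have "\<dots> = (2 / \<bar>a\<bar>) ^ l * (norm (y ^ l *\<^sub>R f y) + \<bar>x0\<bar> ^ l * norm (y ^ 0 *\<^sub>R f y))"
      by (simp add: algebra_simps power_abs)
    also have "\<dots> \<le> (2 / \<bar>a\<bar>) ^ l * (M + \<bar>x0\<bar> ^ l * N)"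
      by (intro mult_left_mono add_mono M N) auto
    finally show ?thesis by (simp add: y_def)
  qed
  then show ?thesis by blast
qed

section \<open>Decay of the energy density along a ray\<close>

lemma parallelogram_law:
  fixes a b :: "'a::real_inner"
  shows "(norm (a - b))\<^sup>2 + (norm (a + b))\<^sup>2 = 2 * ((norm a)\<^sup>2 + (norm b)\<^sup>2)"
  by (simp add: power2_norm_eq_inner inner_simps inner_commute)

theorem theorem1:
  fixes c v x0 :: real and u :: "real \<Rightarrow> real \<Rightarrow> complex" and l :: nat
  assumes "c > 0"
    and "wave_solution c u"
    and "schwartz (\<lambda>x. u 0 x)"
    and "schwartz (\<lambda>x. partial_t u 0 x)"
    and "\<bar>v\<bar> \<noteq> c"
  shows "\<exists>C::real. \<forall>t>0.
           (cmod (partial_t u t (x0 + v * t)))\<^sup>2 + c\<^sup>2 * (cmod (partial_x u t (x0 + v * t)))\<^sup>2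
             \<le> C * t powi (- 2 * int l)"
proof -
  let ?w = "\<lambda>e t x. partial_t u t x - e *\<^sub>R partial_x u t x"
  have decay: "\<exists>K. \<forall>t>0. t ^ l * cmod (?w e t (x0 + v * t)) \<le> K"
    if e: "e\<^sup>2 = c\<^sup>2" "v - e \<noteq> 0" for e
  proof -
    have "rapidly_decreasing (?w e 0)"
      using schwartz_rapidly_decreasing(2)[OF assms(3)] schwartz_rapidly_decreasing(1)[OF assms(4)]
      by (intro rapidly_decreasing_lincomb) (simp_all add: partial_x_def)
    moreover have "?w e t (x0 + v * t) = ?w e 0 (x0 + (v - e) * t)" if "t > 0" for t
    proof -
      have foot: "x0 + v * t - e * t = x0 + (v - e) * t"
        by (simp add: left_diff_distrib)
      show ?thesis
        using riemann_invariant_transported[OF assms(2) e(1) less_imp_le[OF that], of "x0 + v * t"]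
        by (simp only: foot)
    qed
    ultimately show ?thesis
      using rapidly_decreasing_along_ray[of "?w e 0" "v - e" l x0] e(2) by simp
  qed
  \<comment> \<open>The speeds \<open>v - c\<close> and \<open>v + c\<close> are those of the two feet.\<close>
  have speeds: "v - c \<noteq> 0" "v - (- c) \<noteq> 0"
    using assms(1,5) by auto
  obtain K1 where K1: "\<And>t. t > 0 \<Longrightarrow> t ^ l * cmod (?w c t (x0 + v * t)) \<le> K1"
    using decay[OF refl speeds(1)] by blast
  obtain K2 where K2: "\<And>t. t > 0 \<Longrightarrow> t ^ l * cmod (?w (- c) t (x0 + v * t)) \<le> K2"
    using decay[OF power2_minus speeds(2)] by blast
  have "(cmod (partial_t u t (x0 + v * t)))\<^sup>2 + c\<^sup>2 * (cmod (partial_x u t (x0 + v * t)))\<^sup>2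
      \<le> (K1\<^sup>2 + K2\<^sup>2) / 2 * t powi (- 2 * int l)" (is "?E \<le> _") if t: "t > 0" for t
  proof -
    have "2 * ?E = (cmod (?w c t (x0 + v * t)))\<^sup>2 + (cmod (?w (- c) t (x0 + v * t)))\<^sup>2"
      using parallelogram_law[of "partial_t u t (x0 + v * t)" "c *\<^sub>R partial_x u t (x0 + v * t)"]
      by (simp add: power_mult_distrib)
    then have "2 * ?E * (t ^ l)\<^sup>2
        = (t ^ l * cmod (?w c t (x0 + v * t)))\<^sup>2 + (t ^ l * cmod (?w (- c) t (x0 + v * t)))\<^sup>2"
      by (simp add: power_mult_distrib algebra_simps)
    also have "\<dots> \<le> K1\<^sup>2 + K2\<^sup>2"
      by (intro add_mono power_mono K1 K2 t) (use t in auto)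
    finally have "?E * (t ^ l)\<^sup>2 \<le> (K1\<^sup>2 + K2\<^sup>2) / 2"
      by (simp add: algebra_simps)
    then have bound: "?E \<le> (K1\<^sup>2 + K2\<^sup>2) / 2 / (t ^ l)\<^sup>2"
      using t by (simp only: pos_le_divide_eq zero_less_power)
    have "t powi (- 2 * int l) = t powi (- int (2 * l))"
      by simp
    also have "\<dots> = inverse ((t ^ l)\<^sup>2)"
      by (simp only: power_int_minus power_int_of_nat power_even_eq)
    finally show ?thesis
      using bound by (simp only: divide_inverse)
  qed
  then show ?thesis by blast
qed

end
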